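(* Let $M=\{0,1\}$ be the multiplicative monoid and $\alpha$ a strong partial action of $M$ on a semigroup $X$ such that $\operatorname{dom}\alpha_0$ and $\operatorname{im}\alpha_0$ are ideals of $X$. Then the following are equivalent: (i) $\alpha$ is globalizable (in the category of semigroups); (ii) the rewriting system $(X_M^+,\to)$ associated with $\alpha$ is locally confluent; (iii) for all $y\in\operatorname{dom}\alpha_0$ and $x,z\in X^1$: $\alpha_0(xyz)=x\alpha_0(y)z$.
   Context: Let $M$ be a monoid with identity $e$. A strong partial action of $M$ on a set $X$ is a family $\alpha=\{\alpha_m:\operatorname{dom}\alpha_m\to X\}_{m\in M}$ of maps with $\operatorname{dom}\alpha_m\subseteq X$ such that: (1) $\operatorname{dom}\alpha_e=X$ and $\alpha_e=\mathrm{id}_X$; (2) $\alpha_m^{-1}(\operatorname{dom}\alpha_n)=\operatorname{dom}\alpha_{nm}\cap\operatorname{dom}\alpha_m$ for all $m,n\in M$; (3) $\alpha_n\circ\alpha_m=\alpha_{nm}$ on $\alpha_m^{-1}(\operatorname{dom}\alpha_n)$ for all $m,n\in M$. It is a global action if $\operatorname{dom}\alpha_m=X$ for all $m$. A strong partial action (global action) of $M$ on a semigroup $X$ is one on the underlying set such that each $\operatorname{dom}\alpha_m$ is a subsemigroup of $X$ and each $\alpha_m$ is a semigroup homomorphism. Write $\operatorname{im}\alpha_m=\alpha_m(\operatorname{dom}\alpha_m)$. Ideals are two-sided; subsemigroups and ideals are allowed to be empty. $X^1$ denotes the semigroup $X$ with an identity element $1$ adjoined. If $\alpha$ is a strong partial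 action of $M$ on a semigroup $X$ and $\beta$ is a global action of $M$ on a semigroup $Y$, a morphism $\iota:\alpha\to\beta$ is a semigroup homomorphism $\iota:X\to Y$ with $\beta_m(\iota(x))=\iota(\alpha_m(x))$ for all $m\in M$, $x\in\operatorname{dom}\alpha_m$. A globalization of $\alpha$ is a pair $(\beta,\iota)$, with $\beta$ a global action of $M$ on a semigroup and $\iota:\alpha\to\beta$ a morphism, such that for all $x,y\in X$ and $m\in M$ with $\beta_m(\iota(x))=\iota(y)$ one has $x\in\operatorname{dom}\alpha_m$ and $\alpha_m(x)=y$. $\alpha$ is globalizable if it has a globalization. $X_M=(M\times X)/{\approx}$, where $\approx$ is the equivalence relation generated by: $(m,x)\rightharpoonup(n,y)$ iff there is $k\in M$ with $m=nk$, $x\in\operatorname{dom}\alpha_k$ and $y=\alpha_k(x)$. The class of $(m,x)$ is $[m,x]$. $X_M^+$ is the free semigroup on $X_M$ (nonempty words), $X_M^*$ the free monoid. The relation $\to$ on $X_M^+$ is: $u[m,x][m,y]v\to u[m,xy]v$ for all $u,v\in X_M^*$, $m\in M$, $x,y\in X$. $\overset{*}{\to}$ is the reflexive transitive closure of $\to$. A word $w$ is locally confluent if whenever $w\to w_1$ and $w\to w_2$ there is $w'$ with $w_1\overset{*}{\to}w'$ and $w_2\overset{*}{\to}w'$; $(X_M^+,\to)$ is locally confluent if every word is. *)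

theory Defs
  imports "HOL-Library.Z2"
begin

section \<open>Semigroups on a carrier set\<close>

text \<open>Carriers may be empty, and so may subsemigroups and ideals.\<close>

definition semigroup_on :: "'a set \<Rightarrow> ('a \<Rightarrow> 'a \<Rightarrow> 'a) \<Rightarrow> bool" where
  "semigroup_on X f \<longleftrightarrow>
     (\<forall>x\<in>X. \<forall>y\<in>X. f x y \<in> X) \<and>
     (\<forall>x\<in>X. \<forall>y\<in>X. \<forall>z\<in>X. f (f x y) z = f x (f y z))"

definition subsemigroup_on :: "'a set \<Rightarrow> 'a set \<Rightarrow> ('a \<Rightarrow> 'a \<Rightarrow> 'a) \<Rightarrow> bool" where
  "subsemigroup_on S X f \<longleftrightarrow> S \<subseteq> X \<and> (\<forall>x\<in>S. \<forall>y\<in>S. f x y \<in> S)"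

definition ideal_on :: "'a set \<Rightarrow> 'a set \<Rightarrow> ('a \<Rightarrow> 'a \<Rightarrow> 'a) \<Rightarrow> bool" where
  "ideal_on I X f \<longleftrightarrow> I \<subseteq> X \<and> (\<forall>i\<in>I. \<forall>x\<in>X. f x i \<in> I \<and> f i x \<in> I)"

definition semigroup_hom_on ::
  "('a \<Rightarrow> 'b) \<Rightarrow> 'a set \<Rightarrow> ('a \<Rightarrow> 'a \<Rightarrow> 'a) \<Rightarrow> 'b set \<Rightarrow> ('b \<Rightarrow> 'b \<Rightarrow> 'b) \<Rightarrow> bool" where
  "semigroup_hom_on h X f Y g \<longleftrightarrow>
     (\<forall>x\<in>X. h x \<in> Y) \<and> (\<forall>x\<in>X. \<forall>y\<in>X. h (f x y) = g (h x) (h y))"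

text \<open>The semigroup $X^1$; a new identity is adjoined even if $X$ already has one.\<close>

datatype 'a adj = One | Elt 'a

fun adj_mult :: "('a \<Rightarrow> 'a \<Rightarrow> 'a) \<Rightarrow> 'a adj \<Rightarrow> 'a adj \<Rightarrow> 'a adj" where
  "adj_mult f One w = w"
| "adj_mult f (Elt x) One = Elt x"
| "adj_mult f (Elt x) (Elt y) = Elt (f x y)"

definition adj_carrier :: "'a set \<Rightarrow> 'a adj set" where
  "adj_carrier X = insert One (Elt ` X)"

section \<open>Strong partial actions\<close>

text \<open>
  The acting monoid is a type of class \<^class>\<open>monoid_mult\<close>; the multiplicative monoid
  $\{0, 1\}$ is the type \<^typ>\<open>bit\<close>. The partial map $\alpha_m$ is the
  map \<open>\<alpha> m\<close>, so its domain and image are \<open>dom (\<alpha> m)\<close> and \<open>ran (\<alpha> m)\<close>, and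
  \<open>\<alpha> m -` (Some ` S)\<close> is the preimage of \<open>S\<close> under $\alpha_m$.
\<close>

definition strong_partial_action :: "('m::monoid_mult \<Rightarrow> 'a \<rightharpoonup> 'a) \<Rightarrow> 'a set \<Rightarrow> bool" where
  "strong_partial_action \<alpha> X \<longleftrightarrow>
     (\<forall>m. dom (\<alpha> m) \<subseteq> X \<and> ran (\<alpha> m) \<subseteq> X) \<and>
     dom (\<alpha> 1) = X \<and> (\<forall>x\<in>X. \<alpha> 1 x = Some x) \<and>
     (\<forall>m n. \<alpha> m -` (Some ` dom (\<alpha> n)) = dom (\<alpha> (n * m)) \<inter> dom (\<alpha> m)) \<and>
     (\<forall>m n. \<forall>x \<in> \<alpha> m -` (Some ` dom (\<alpha> n)). (\<alpha> n \<circ>\<^sub>m \<alpha> m) x = \<alpha> (n * m) x)"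

definition semigroup_partial_action ::
  "('m::monoid_mult \<Rightarrow> 'a \<rightharpoonup> 'a) \<Rightarrow> 'a set \<Rightarrow> ('a \<Rightarrow> 'a \<Rightarrow> 'a) \<Rightarrow> bool" where
  "semigroup_partial_action \<alpha> X f \<longleftrightarrow>
     strong_partial_action \<alpha> X \<and>
     (\<forall>m. subsemigroup_on (dom (\<alpha> m)) X f \<and>
          semigroup_hom_on (\<lambda>x. the (\<alpha> m x)) (dom (\<alpha> m)) f X f)"

definition semigroup_global_action ::
  "('m::monoid_mult \<Rightarrow> 'a \<rightharpoonup> 'a) \<Rightarrow> 'a set \<Rightarrow> ('a \<Rightarrow> 'a \<Rightarrow> 'a) \<Rightarrow> bool" where
  "semigroup_global_action \<alpha> X f \<longleftrightarrow>
     semigroup_partial_action \<alpha> X f \<and> (\<forall>m. dom (\<alpha> m) = X)"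

definition action_morphism ::
  "('m::monoid_mult \<Rightarrow> 'a \<rightharpoonup> 'a) \<Rightarrow> 'a set \<Rightarrow> ('a \<Rightarrow> 'a \<Rightarrow> 'a) \<Rightarrow>
   ('m \<Rightarrow> 'b \<rightharpoonup> 'b) \<Rightarrow> 'b set \<Rightarrow> ('b \<Rightarrow> 'b \<Rightarrow> 'b) \<Rightarrow> ('a \<Rightarrow> 'b) \<Rightarrow> bool" where
  "action_morphism \<alpha> X f \<beta> Y g \<iota> \<longleftrightarrow>
     semigroup_hom_on \<iota> X f Y g \<and>
     (\<forall>m. \<forall>x \<in> dom (\<alpha> m). \<beta> m (\<iota> x) = Some (\<iota> (the (\<alpha> m x))))"

definition globalization ::
  "('m::monoid_mult \<Rightarrow> 'a \<rightharpoonup> 'a) \<Rightarrow> 'a set \<Rightarrow> ('a \<Rightarrow> 'a \<Rightarrow> 'a) \<Rightarrow>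
   ('m \<Rightarrow> 'b \<rightharpoonup> 'b) \<Rightarrow> 'b set \<Rightarrow> ('b \<Rightarrow> 'b \<Rightarrow> 'b) \<Rightarrow> ('a \<Rightarrow> 'b) \<Rightarrow> bool" where
  "globalization \<alpha> X f \<beta> Y g \<iota> \<longleftrightarrow>
     semigroup_on Y g \<and> semigroup_global_action \<beta> Y g \<and> action_morphism \<alpha> X f \<beta> Y g \<iota> \<and>
     (\<forall>x\<in>X. \<forall>y\<in>X. \<forall>m. \<beta> m (\<iota> x) = Some (\<iota> y) \<longrightarrow> \<alpha> m x = Some y)"

text \<open>
  HOL cannot quantify over the type of the globalizing semigroup. Its elements are therefore
  taken from the type of words over $M \times X$. This is no restriction: by
  \<open>globalization_imp_globalizable\<close> below, a globalization on a semigroup of any type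
  yields one of this form.
\<close>

definition globalizable ::
  "('m::monoid_mult \<Rightarrow> 'a \<rightharpoonup> 'a) \<Rightarrow> 'a set \<Rightarrow> ('a \<Rightarrow> 'a \<Rightarrow> 'a) \<Rightarrow> bool" where
  "globalizable \<alpha> X f \<longleftrightarrow>
     (\<exists>(\<beta> :: 'm \<Rightarrow> ('m \<times> 'a) list \<rightharpoonup> ('m \<times> 'a) list) Y g \<iota>. globalization \<alpha> X f \<beta> Y g \<iota>)"

subsection \<open>Independence of the type of the globalizing semigroup\<close>

fun word_prod :: "('b \<Rightarrow> 'b \<Rightarrow> 'b) \<Rightarrow> 'b list \<Rightarrow> 'b" where
  "word_prod g [] = undefined"
| "word_prod g [x] = x"
| "word_prod g (x # y # xs) = g x (word_prod g (y # xs))"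

lemma word_prod_closed:
  assumes "semigroup_on Y g" "xs \<noteq> []" "set xs \<subseteq> Y"
  shows "word_prod g xs \<in> Y"
  using assms(2,3)
proof (induction xs rule: induct_list012)
  case (3 x y zs)
  then show ?case using assms(1) by (auto simp: semigroup_on_def)
qed auto

lemma word_prod_append:
  assumes "semigroup_on Y g" "xs \<noteq> []" "ys \<noteq> []" "set xs \<subseteq> Y" "set ys \<subseteq> Y"
  shows "word_prod g (xs @ ys) = g (word_prod g xs) (word_prod g ys)"
  using assms(2,4)
proof (induction xs rule: induct_list012)
  case (2 x)
  then show ?case using assms(3) by (cases ys) auto
next
  case (3 x y zs)
  have "word_prod g (y # zs) \<in> Y" "word_prod g ys \<in> Y" "x \<in> Y"
    using 3 assms by (auto intro!: word_prod_closed[OF assms(1)])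
  then show ?case using 3 assms(1) by (simp add: semigroup_on_def)
qed auto

lemma word_prod_map:
  assumes "semigroup_on Y g" "xs \<noteq> []" "set xs \<subseteq> Y"
    and "\<And>u v. u \<in> Y \<Longrightarrow> v \<in> Y \<Longrightarrow> h (g u v) = g (h u) (h v)"
  shows "h (word_prod g xs) = word_prod g (map h xs)"
  using assms(2,3)
proof (induction xs rule: induct_list012)
  case (3 x y zs)
  have "word_prod g (y # zs) \<in> Y" "x \<in> Y"
    using 3 by (auto intro!: word_prod_closed[OF assms(1)])
  then show ?case using 3 assms(4) by simp
qed auto

lemma global_actionI:
  assumes "\<And>m y. y \<in> Y \<Longrightarrow> b m y \<in> Y" "\<And>y. y \<in> Y \<Longrightarrow> b 1 y = y"
    and "\<And>m n y. y \<in> Y \<Longrightarrow> b n (b m y) = b (n * m) y"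
    and "\<And>m x y. x \<in> Y \<Longrightarrow> y \<in> Y \<Longrightarrow> b m (g x y) = g (b m x) (b m y)"
    and "semigroup_on Y g"
  shows "semigroup_global_action (\<lambda>m y. if y \<in> Y then Some (b m y) else None) Y g"
  using assms
  by (auto simp: semigroup_global_action_def semigroup_partial_action_def
      strong_partial_action_def subsemigroup_on_def semigroup_hom_on_def semigroup_on_def
      map_comp_def ran_def dom_def split: if_splits)

lemma global_actionD:
  assumes "semigroup_global_action \<beta> Y g" "semigroup_on Y g"
  defines "b \<equiv> \<lambda>m y. the (\<beta> m y)"
  shows "y \<in> Y \<Longrightarrow> \<beta> m y = Some (b m y)"
    and "y \<in> Y \<Longrightarrow> b m y \<in> Y"
    and "y \<in> Y \<Longrightarrow> b 1 y = y"
    and "y \<in> Y \<Longrightarrow> b n (b m y) = b (n * m) y"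
    and "x \<in> Y \<Longrightarrow> y \<in> Y \<Longrightarrow> b m (g x y) = g (b m x) (b m y)"
proof -
  have spa: "strong_partial_action \<beta> Y" and dom: "\<And>m. dom (\<beta> m) = Y"
    and hom: "\<And>m. semigroup_hom_on (\<lambda>x. the (\<beta> m x)) Y g Y g"
    using assms(1) by (auto simp: semigroup_global_action_def semigroup_partial_action_def)
  show S: "\<beta> m y = Some (b m y)" if "y \<in> Y" for m y
    using that dom[of m] by (auto simp: b_def)
  show C: "b m y \<in> Y" if "y \<in> Y" for m y
    using that hom[of m] by (auto simp: semigroup_hom_on_def b_def)
  show "b 1 y = y" if "y \<in> Y"
    using that spa by (auto simp: strong_partial_action_def b_def)
  show "b m (g x y) = g (b m x) (b m y)" if "x \<in> Y" "y \<in> Y"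
    using that hom[of m] by (auto simp: semigroup_hom_on_def b_def)
  show "b n (b m y) = b (n * m) y" if y: "y \<in> Y"
  proof -
    have "y \<in> \<beta> m -` (Some ` dom (\<beta> n))" using S[OF y] C[OF y] dom by auto
    then have "(\<beta> n \<circ>\<^sub>m \<beta> m) y = \<beta> (n * m) y"
      using spa unfolding strong_partial_action_def by blast
    then show ?thesis using S[OF y] S[OF C[OF y]] by (simp add: map_comp_def)
  qed
qed

lemma globalization_imp_globalizable:
  fixes \<alpha> :: "'m::monoid_mult \<Rightarrow> 'a \<rightharpoonup> 'a" and \<beta> :: "'m \<Rightarrow> 'b \<rightharpoonup> 'b"
  assumes "semigroup_on X f" "semigroup_partial_action \<alpha> X f" "globalization \<alpha> X f \<beta> Y g \<iota>"
  shows "globalizable \<alpha> X f"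
proof -
  define b where "b m y = the (\<beta> m y)" for m y
  have Y: "semigroup_on Y g" and act: "semigroup_global_action \<beta> Y g"
    and mor: "action_morphism \<alpha> X f \<beta> Y g \<iota>"
    and glob: "\<And>x y m. x \<in> X \<Longrightarrow> y \<in> X \<Longrightarrow> \<beta> m (\<iota> x) = Some (\<iota> y) \<Longrightarrow> \<alpha> m x = Some y"
    using assms(3) by (auto simp: globalization_def)
  note b = global_actionD[OF act Y, folded b_def]
  have \<iota>: "\<iota> x \<in> Y" "\<iota> (f x y) = g (\<iota> x) (\<iota> y)" if "x \<in> X" "y \<in> X" for x y
    using mor that by (auto simp: action_morphism_def semigroup_hom_on_def)
  have \<alpha>X: "dom (\<alpha> m) \<subseteq> X" for m
    using assms(2) unfolding semigroup_partial_action_def strong_partial_action_def by blast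

  define t where "t = (\<lambda>(m, x). b m (\<iota> x))"
  define ev where "ev = (\<lambda>ps. word_prod g (map t ps))"
  define L :: "('m \<times> 'a) list set" where "L = {ps. ps \<noteq> [] \<and> set ps \<subseteq> UNIV \<times> X}"
  have tY: "t p \<in> Y" if "p \<in> UNIV \<times> X" for p
    using that b(2) \<iota>(1) by (auto simp: t_def)
  have setY: "set (map t ps) \<subseteq> Y" if "ps \<in> L" for ps
    using that tY by (force simp: L_def)
  have evY: "ev ps \<in> Y" if "ps \<in> L" for ps
    unfolding ev_def using that setY[OF that]
    by (intro word_prod_closed[OF Y]) (auto simp: L_def)
  have ev_app: "ev (ps @ qs) = g (ev ps) (ev qs)" "ps @ qs \<in> L" if "ps \<in> L" "qs \<in> L" for ps qs
    using that setY[OF that(1)] setY[OF that(2)] word_prod_append[OF Y, of "map t ps" "map t qs"]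
    by (auto simp: L_def ev_def)
  have ev_act: "b m (ev ps) = ev (map (\<lambda>(n, x). (m * n, x)) ps)"
      "map (\<lambda>(n, x). (m * n, x)) ps \<in> L" if "ps \<in> L" for m ps
  proof -
    have "b m (ev ps) = word_prod g (map (b m) (map t ps))"
      unfolding ev_def using that setY[OF that] b(5)
      by (intro word_prod_map[OF Y]) (auto simp: L_def)
    also have "map (b m) (map t ps) = map t (map (\<lambda>(n, x). (m * n, x)) ps)"
      using that b(4) \<iota>(1) by (auto simp: L_def t_def)
    finally show "b m (ev ps) = ev (map (\<lambda>(n, x). (m * n, x)) ps)" by (simp add: ev_def)
    show "map (\<lambda>(n, x). (m * n, x)) ps \<in> L" using that by (auto simp: L_def)
  qed
  define Y' where "Y' = ev ` L"
  have Y'Y: "y \<in> Y' \<Longrightarrow> y \<in> Y" for y using evY by (auto simp: Y'_def)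
  have gY': "g u v \<in> Y'" if uv: "u \<in> Y'" "v \<in> Y'" for u v
  proof -
    obtain ps qs where "ps \<in> L" "qs \<in> L" "u = ev ps" "v = ev qs" using uv by (auto simp: Y'_def)
    then show ?thesis using ev_app[of ps qs] by (auto simp: Y'_def intro!: image_eqI[of _ ev "ps @ qs"])
  qed
  have bY': "b m u \<in> Y'" if u: "u \<in> Y'" for m u
    using u ev_act by (auto simp: Y'_def)
  have \<iota>Y': "\<iota> x \<in> Y'" if x: "x \<in> X" for x
  proof -
    have "[(1, x)] \<in> L" "ev [(1, x)] = \<iota> x"
      using x b(3) \<iota>(1) by (auto simp: L_def ev_def t_def)
    then show ?thesis by (force simp: Y'_def)
  qed

  define r where "r = inv_into L ev"
  have evr: "ev (r y) = y" if "y \<in> Y'" for y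
    using that by (auto simp: r_def Y'_def f_inv_into_f)
  define Z where "Z = r ` Y'"
  have Z: "u \<in> Z \<Longrightarrow> ev u \<in> Y'" "u \<in> Z \<Longrightarrow> r (ev u) = u" "y \<in> Y' \<Longrightarrow> r y \<in> Z" for u y
    using evr by (auto simp: Z_def)
  define g' where "g' = (\<lambda>u v. r (g (ev u) (ev v)))"
  define b' where "b' = (\<lambda>m u. r (b m (ev u)))"
  define \<beta>' where "\<beta>' = (\<lambda>m u. if u \<in> Z then Some (b' m u) else None)"
  define \<iota>' where "\<iota>' = (\<lambda>x. r (\<iota> x))"
  have Zs: "semigroup_on Z g'"
    unfolding semigroup_on_def g'_def
    using Z gY' Y'Y evr Y by (auto simp: semigroup_on_def)
  have "semigroup_global_action \<beta>' Z g'"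
    unfolding \<beta>'_def
    by (rule global_actionI[OF _ _ _ _ Zs])
      (use Z gY' bY' Y'Y evr b in \<open>auto simp: g'_def b'_def\<close>)
  moreover have "action_morphism \<alpha> X f \<beta>' Z g' \<iota>'"
    unfolding action_morphism_def semigroup_hom_on_def
  proof (intro conjI ballI allI)
    fix m x assume x: "x \<in> dom (\<alpha> m)"
    then have xX: "x \<in> X" using \<alpha>X by auto
    have "\<beta> m (\<iota> x) = Some (\<iota> (the (\<alpha> m x)))" using mor x by (auto simp: action_morphism_def)
    then have "b m (\<iota> x) = \<iota> (the (\<alpha> m x))" by (simp add: b_def)
    then show "\<beta>' m (\<iota>' x) = Some (\<iota>' (the (\<alpha> m x)))"
      using Z \<iota>Y'[OF xX] evr by (auto simp: \<beta>'_def b'_def \<iota>'_def)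
  qed (use Z \<iota>Y' \<iota> evr in \<open>auto simp: \<iota>'_def g'_def\<close>)
  moreover have "\<alpha> m x = Some y"
    if xy: "x \<in> X" "y \<in> X" and e: "\<beta>' m (\<iota>' x) = Some (\<iota>' y)" for x y m
  proof -
    have "r (b m (\<iota> x)) = r (\<iota> y)"
      using e Z \<iota>Y' xy evr by (auto simp: \<beta>'_def b'_def \<iota>'_def split: if_splits)
    then have "b m (\<iota> x) = \<iota> y" using evr bY' \<iota>Y' xy by metis
    then show ?thesis using glob[OF xy] b(1) \<iota>(1) xy by auto
  qed
  ultimately have "globalization \<alpha> X f \<beta>' Z g' \<iota>'"
    using Zs by (auto simp: globalization_def)
  then show ?thesis unfolding globalizable_def by blast
qed

section \<open>The rewriting system associated with a partial action\<close>

definition arrow :: "('m::monoid_mult \<Rightarrow> 'a \<rightharpoonup> 'a) \<Rightarrow> 'm \<times> 'a \<Rightarrow> 'm \<times> 'a \<Rightarrow> bool" where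
  "arrow \<alpha> = (\<lambda>(m, x) (n, y). \<exists>k. m = n * k \<and> \<alpha> k x = Some y)"

definition XM_rel :: "('m::monoid_mult \<Rightarrow> 'a \<rightharpoonup> 'a) \<Rightarrow> ('m \<times> 'a) rel" where
  "XM_rel \<alpha> = {(p, q). equivclp (arrow \<alpha>) p q}"

text \<open>
  The relation \<open>arrow \<alpha>\<close> only relates elements of $M \times X$, so the \<open>XM_rel \<alpha>\<close>-class of an
  element of $M \times X$ is its class for the equivalence relation generated on $M \times X$.
\<close>

definition XM :: "('m::monoid_mult \<Rightarrow> 'a \<rightharpoonup> 'a) \<Rightarrow> 'a set \<Rightarrow> ('m \<times> 'a) set set" where
  "XM \<alpha> X = (UNIV \<times> X) // XM_rel \<alpha>"

definition XM_class :: "('m::monoid_mult \<Rightarrow> 'a \<rightharpoonup> 'a) \<Rightarrow> 'm \<Rightarrow> 'a \<Rightarrow> ('m \<times> 'a) set" where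
  "XM_class \<alpha> m x = XM_rel \<alpha> `` {(m, x)}"

definition XM_plus :: "('m::monoid_mult \<Rightarrow> 'a \<rightharpoonup> 'a) \<Rightarrow> 'a set \<Rightarrow> ('m \<times> 'a) set list set" where
  "XM_plus \<alpha> X = lists (XM \<alpha> X) - {[]}"

definition rewrite ::
  "('m::monoid_mult \<Rightarrow> 'a \<rightharpoonup> 'a) \<Rightarrow> 'a set \<Rightarrow> ('a \<Rightarrow> 'a \<Rightarrow> 'a) \<Rightarrow>
   ('m \<times> 'a) set list \<Rightarrow> ('m \<times> 'a) set list \<Rightarrow> bool" where
  "rewrite \<alpha> X f w w' \<longleftrightarrow>
     (\<exists>u \<in> lists (XM \<alpha> X). \<exists>v \<in> lists (XM \<alpha> X). \<exists>m. \<exists>x\<in>X. \<exists>y\<in>X.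
        w = u @ [XM_class \<alpha> m x, XM_class \<alpha> m y] @ v \<and>
        w' = u @ [XM_class \<alpha> m (f x y)] @ v)"

definition locally_confluent_word :: "('w \<Rightarrow> 'w \<Rightarrow> bool) \<Rightarrow> 'w \<Rightarrow> bool" where
  "locally_confluent_word R w \<longleftrightarrow>
     (\<forall>w1 w2. R w w1 \<and> R w w2 \<longrightarrow> (\<exists>w'. R\<^sup>*\<^sup>* w1 w' \<and> R\<^sup>*\<^sup>* w2 w'))"

definition locally_confluent ::
  "('m::monoid_mult \<Rightarrow> 'a \<rightharpoonup> 'a) \<Rightarrow> 'a set \<Rightarrow> ('a \<Rightarrow> 'a \<Rightarrow> 'a) \<Rightarrow> bool" where
  "locally_confluent \<alpha> X f \<longleftrightarrow>
     (\<forall>w \<in> XM_plus \<alpha> X. locally_confluent_word (rewrite \<alpha> X f) w)"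

end

(*
  Since 0 is idempotent, a = \<alpha> 0 is a retraction of its domain onto its image. Hence every class
  of X_M has a unique representative (m, x) with m = 1 or x outside the domain of a; call the map
  onto these representatives N. Condition (iii) says exactly that the kernel of N is a congruence
  for the componentwise product of M \<times> X. So under (iii) the representatives form a semigroup,
  on which M acts by multiplication of the first component: this is a globalization. As every
  element of M is idempotent, a rewriting step replaces two adjacent classes by their product in
  that semigroup, so local confluence is associativity. Conversely, in a globalization the element
  0 (x y) = (0 x) (0 y) depends on y only through a y, so a (x y) = a (x (a y)) = x (a y), because
  the image of a is an ideal. Local confluence of the word [0, x] [0, y] = [0, x] [0, a y] gives the
  same equation.
*)
theory Submission
  imports Defs
begin

section \<open>Local confluence for contraction by a partial product\<close>

text \<open>Critical pairs: two contracted pairs in one word coincide, share one letter, or are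
  disjoint. \<open>unique\<close> settles the first case and \<open>assoc\<close> the second;
  disjoint contractions commute.\<close>

lemma locally_confluent_partial_product:
  fixes P :: "'b \<Rightarrow> 'b \<Rightarrow> 'b \<Rightarrow> bool"
  assumes R: "\<And>w w'. R w w' \<longleftrightarrow>
      (\<exists>u\<in>lists C. \<exists>v\<in>lists C. \<exists>p q r. P p q r \<and> w = u @ [p, q] @ v \<and> w' = u @ [r] @ v)"
    and closed: "\<And>p q r. P p q r \<Longrightarrow> p \<in> C \<and> q \<in> C \<and> r \<in> C"
    and unique: "\<And>p q r r'. P p q r \<Longrightarrow> P p q r' \<Longrightarrow> r = r'"
    and assoc: "\<And>p q r s t. P p q s \<Longrightarrow> P q r t \<Longrightarrow> \<exists>z. P s r z \<and> P p t z"
  shows "locally_confluent_word R w"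
proof -
  have RI: "R\<^sup>*\<^sup>* (u @ [p, q] @ v) (u @ [r] @ v)" if "P p q r" "u \<in> lists C" "v \<in> lists C" for p q r u v
    using that R by (intro r_into_rtranclp) blast
  have join: "\<exists>w'. R\<^sup>*\<^sup>* (u @ [r] @ v) w' \<and> R\<^sup>*\<^sup>* (u' @ [r'] @ v') w'"
    if l: "u \<in> lists C" "v \<in> lists C" "u' \<in> lists C" "v' \<in> lists C"
      and P: "P p q r" "P p' q' r'"
      and e: "u @ [p, q] @ v = u' @ [p', q'] @ v'" and le: "length u \<le> length u'"
    for u v u' v' p q r p' q' r'
  proof -
    obtain t where t: "u' = u @ t"
      using e le by (metis append_eq_append_conv_if append_take_drop_id)
    with e have e': "p # q # v = t @ p' # q' # v'" by simp
    \<comment> \<open>\<open>t\<close> is the stretch between the starts of the two pairs, so length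
      0, 1 or at least 2 decides how they overlap. \<open>remdups_adj.cases\<close> merely supplies
      this split of lists.\<close>
    consider "t = []" | "t = [p]" | s where "t = p # q # s"
      using e' by (cases t rule: remdups_adj.cases) auto
    then show ?thesis
    proof cases
      case 1
      then have "r = r'" "u = u'" "v = v'" using e' t P unique by auto
      then show ?thesis by blast
    next
      case 2
      then have "q = p'" "v = q' # v'" using e' by auto
      moreover from this obtain z where "P r q' z" "P p r' z" using assoc P by blast
      ultimately show ?thesis
        using t 2 l RI[of r q' z u v'] RI[of p r' z u v'] by auto
    next
      case 3
      then have v: "v = s @ [p', q'] @ v'" using e' by auto
      have s: "s \<in> lists C" using v l by auto
      have "R\<^sup>*\<^sup>* (u @ [r] @ v) (u @ [r] @ s @ [r'] @ v')"
        using RI[OF P(2), of "u @ [r] @ s" v'] v l s closed[OF P(1)] by auto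
      moreover have "R\<^sup>*\<^sup>* (u' @ [r'] @ v') (u @ [r] @ s @ [r'] @ v')"
        using RI[OF P(1), of u "s @ [r'] @ v'"] t 3 l s closed[OF P(2)] by auto
      ultimately show ?thesis by blast
    qed
  qed
  show ?thesis
    unfolding locally_confluent_word_def
  proof (intro allI impI, elim conjE)
    fix w1 w2 assume "R w w1" "R w w2"
    then obtain u v p q r u' v' p' q' r' where
      "u \<in> lists C" "v \<in> lists C" "P p q r" "w = u @ [p, q] @ v" "w1 = u @ [r] @ v"
      "u' \<in> lists C" "v' \<in> lists C" "P p' q' r'" "w = u' @ [p', q'] @ v'" "w2 = u' @ [r'] @ v'"
      unfolding R by blast
    then show "\<exists>w'. R\<^sup>*\<^sup>* w1 w' \<and> R\<^sup>*\<^sup>* w2 w'"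
      using join[of u v u' v' p q r p' q' r'] join[of u' v' u v p' q' r' p q r]
      by (metis nat_le_linear)
  qed
qed

text \<open>One-letter words are irreducible, so two of them are joinable only if they are
  equal.\<close>

lemma rewrite_singleton: "\<not> rewrite \<alpha> X f [p] w"
  by (auto simp: rewrite_def Cons_eq_append_conv)

section \<open>Partial actions of {0, 1} and condition (iii)\<close>

locale bit_partial_action =
  fixes \<alpha> :: "bit \<Rightarrow> 'a \<rightharpoonup> 'a" and X :: "'a set" and f :: "'a \<Rightarrow> 'a \<Rightarrow> 'a"
  assumes semigroup: "semigroup_on X f"
    and action: "semigroup_partial_action \<alpha> X f"
    and ideal_dom: "ideal_on (dom (\<alpha> 0)) X f"
    and ideal_ran: "ideal_on (ran (\<alpha> 0)) X f"
begin

definition D :: "'a set" where "D = dom (\<alpha> 0)"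

definition a :: "'a \<Rightarrow> 'a" where "a x = the (\<alpha> 0 x)"

lemma f_closed [simp]: "x \<in> X \<Longrightarrow> y \<in> X \<Longrightarrow> f x y \<in> X"
  and f_assoc: "x \<in> X \<Longrightarrow> y \<in> X \<Longrightarrow> z \<in> X \<Longrightarrow> f (f x y) z = f x (f y z)"
  using semigroup by (auto simp: semigroup_on_def)

lemma D_subset: "x \<in> D \<Longrightarrow> x \<in> X"
  using ideal_dom by (auto simp: ideal_on_def D_def)

lemma D_ideal [simp]: "x \<in> D \<Longrightarrow> y \<in> X \<Longrightarrow> f x y \<in> D" "y \<in> X \<Longrightarrow> x \<in> D \<Longrightarrow> f y x \<in> D"
  using ideal_dom unfolding ideal_on_def D_def by blast+

lemma \<alpha>_0: "x \<in> D \<Longrightarrow> \<alpha> 0 x = Some (a x)"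
  by (auto simp: a_def D_def)

lemma \<alpha>_1: "\<alpha> 1 x = (if x \<in> X then Some x else None)"
  using action unfolding semigroup_partial_action_def strong_partial_action_def by auto

text \<open>Both come from the axioms of a strong partial action for m = n = 0, since 0 * 0 =
  0.\<close>

lemma a_D [simp]: "x \<in> D \<Longrightarrow> a x \<in> D"
  and a_idem [simp]: "x \<in> D \<Longrightarrow> a (a x) = a x"
proof -
  assume x: "x \<in> D"
  have spa: "strong_partial_action \<alpha> X" using action by (simp add: semigroup_partial_action_def)
  then have "\<alpha> 0 -` (Some ` D) = dom (\<alpha> (0 * 0)) \<inter> D"
    unfolding strong_partial_action_def D_def by blast
  then have v: "x \<in> \<alpha> 0 -` (Some ` D)" using x by (auto simp: D_def)
  then show D: "a x \<in> D" using \<alpha>_0[OF x] by auto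
  from v spa have "(\<alpha> 0 \<circ>\<^sub>m \<alpha> 0) x = \<alpha> (0 * 0) x"
    unfolding strong_partial_action_def D_def by blast
  then show "a (a x) = a x" using \<alpha>_0[OF x] \<alpha>_0[OF D] by (simp add: map_comp_def)
qed

lemma a_X [simp]: "x \<in> D \<Longrightarrow> a x \<in> X"
  using D_subset by simp

text \<open>By idempotence \<open>a\<close> fixes every point of \<open>ran (\<alpha> 0)\<close>,
  and this set absorbs multiplication by \<open>X\<close>.\<close>

lemma a_image_ideal:
  assumes "x \<in> X" "y \<in> D"
  shows "a (f x (a y)) = f x (a y)" "a (f (a y) x) = f (a y) x"
proof -
  have "a y \<in> ran (\<alpha> 0)" using \<alpha>_0[OF assms(2)] by (auto simp: ran_def)
  then have "f x (a y) \<in> ran (\<alpha> 0)" "f (a y) x \<in> ran (\<alpha> 0)"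
    using ideal_ran assms(1) by (auto simp: ideal_on_def)
  moreover have "a z = z" if z: "z \<in> ran (\<alpha> 0)" for z
    proof -
    obtain y where "\<alpha> 0 y = Some z" using z by (auto simp: ran_def)
    then have "y \<in> D" "z = a y" by (auto simp: a_def D_def)
    then show ?thesis by simp
  qed
  ultimately show "a (f x (a y)) = f x (a y)" "a (f (a y) x) = f (a y) x" by auto
qed

definition bilinear :: bool where
  "bilinear \<longleftrightarrow> (\<forall>x\<in>X. \<forall>y\<in>D. a (f x y) = f x (a y) \<and> a (f y x) = f (a y) x)"

text \<open>Applying the one-sided equations in turn gives the two-sided one; setting x or z to
  \<open>One\<close> recovers them. A product with the factor \<open>Elt y\<close> is never
  \<open>One\<close> and stays in the ideal \<open>D\<close>, which provides the witnesses.\<close>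

lemma bilinear_iff:
  "bilinear \<longleftrightarrow> (\<forall>y \<in> dom (\<alpha> 0). \<forall>x \<in> adj_carrier X. \<forall>z \<in> adj_carrier X.
     \<exists>w w'. Elt w = adj_mult f (adj_mult f x (Elt y)) z \<and> \<alpha> 0 w = Some w' \<and>
            Elt w' = adj_mult f (adj_mult f x (Elt (the (\<alpha> 0 y)))) z)" (is "_ \<longleftrightarrow> ?R")
proof
  assume b: bilinear
  have "\<exists>w w'. Elt w = adj_mult f (adj_mult f x (Elt y)) z \<and> \<alpha> 0 w = Some w' \<and>
            Elt w' = adj_mult f (adj_mult f x (Elt (a y))) z"
    if "y \<in> D" "x \<in> adj_carrier X" "z \<in> adj_carrier X" for x y z
    using that b by (auto simp: adj_carrier_def bilinear_def \<alpha>_0)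
  then show ?R unfolding a_def D_def by blast
next
  assume r: ?R
  show bilinear unfolding bilinear_def
  proof (intro ballI conjI)
    fix x y assume xy: "x \<in> X" "y \<in> D"
    then have c: "Elt x \<in> adj_carrier X" "One \<in> adj_carrier X" by (auto simp: adj_carrier_def)
    show "a (f x y) = f x (a y)" using r[rule_format, OF xy(2)[unfolded D_def] c] by (auto simp: a_def)
    show "a (f y x) = f (a y) x" using r[rule_format, OF xy(2)[unfolded D_def] c(2,1)] by (auto simp: a_def)
  qed
qed

section \<open>Normal forms and their products\<close>

definition N :: "bit \<times> 'a \<Rightarrow> bit \<times> 'a" where
  "N = (\<lambda>(m, x). if m = 0 \<and> x \<in> D then (1, a x) else (m, x))"

lemma N_1 [simp]: "N (1, x) = (1, x)"
  and N_0 [simp]: "x \<in> D \<Longrightarrow> N (0, x) = (1, a x)"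
  and N_0' [simp]: "x \<notin> D \<Longrightarrow> N (0, x) = (0, x)"
  by (auto simp: N_def)

text \<open>For k = 1 the arrow is an identity. For k = 0 it leads from (0, x) to (n, a x), and both
  normalize to (1, a x); for n = 0 this needs a (a x) = a x.\<close>

lemma N_arrow: "arrow \<alpha> p q \<Longrightarrow> N p = N q"
proof -
  assume "arrow \<alpha> p q"
  then obtain n k x y where p: "p = (n * k, x)" "q = (n, y)" "\<alpha> k x = Some y"
    by (auto simp: arrow_def)
  show "N p = N q"
  proof (cases "k = 0")
    case True
    then have "x \<in> D" "y = a x" using p by (auto simp: a_def D_def)
    then show ?thesis using p True by (cases n) auto
  next
    case False
    then show ?thesis using p \<alpha>_1 by (auto split: if_splits)
  qed
qed

lemma arrow_N: "equivclp (arrow \<alpha>) p (N p)"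
proof (cases "fst p = 0 \<and> snd p \<in> D")
  case True
  then have "arrow \<alpha> p (N p)" by (cases p) (auto simp: arrow_def \<alpha>_0)
  then show ?thesis by (rule r_into_equivclp)
next
  case False
  then show ?thesis by (cases p) (auto simp: N_def)
qed

text \<open>\<open>N\<close> is constant along arrows and every pair is equivalent to its normal
  form, so the generated equivalence is the kernel of \<open>N\<close>.\<close>

lemma XM_rel_eq: "XM_rel \<alpha> = {(p, q). N p = N q}"
proof -
  have "N p = N q" if "equivclp (arrow \<alpha>) p q" for p q
    using that by (induction rule: equivclp_induct) (auto dest: N_arrow)
  moreover have "equivclp (arrow \<alpha>) p q" if "N p = N q" for p q
    using that arrow_N[of p] arrow_N[of q] by (metis equivclp_sym equivclp_trans)
  ultimately show ?thesis unfolding XM_rel_def by blast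
qed

lemma XM_class_eq_iff: "XM_class \<alpha> m x = XM_class \<alpha> n y \<longleftrightarrow> N (m, x) = N (n, y)"
  by (auto simp: XM_class_def XM_rel_eq)

lemma XM_class_XM: "x \<in> X \<Longrightarrow> XM_class \<alpha> m x \<in> XM \<alpha> X"
  by (auto simp: XM_class_def XM_def intro: quotientI)

definition prod :: "bit \<times> 'a \<Rightarrow> bit \<times> 'a \<Rightarrow> bit \<times> 'a" (infixl \<open>\<bullet>\<close> 70) where
  "p \<bullet> q = (fst p * fst q, f (snd p) (snd q))"

lemma N_X: "snd p \<in> X \<Longrightarrow> snd (N p) \<in> X"
  by (auto simp: N_def split: prod.splits)

text \<open>Only the replacement of (0, x), with x in \<open>D\<close>, by (1, a x) matters. If the
  other factor has level 1, the claim is \<open>bilinear\<close> itself; at level 0 both products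
  are normalized by \<open>a\<close>, and \<open>a_image_ideal\<close> reduces the claim to
  \<open>bilinear\<close>.\<close>

lemma N_prod:
  assumes bilinear "snd p \<in> X" "snd q \<in> X"
  shows "N (N p \<bullet> q) = N (p \<bullet> q)" "N (p \<bullet> N q) = N (p \<bullet> q)"
proof -
  obtain m x n y where pq: "p = (m, x)" "q = (n, y)" by (cases p, cases q)
  show "N (N p \<bullet> q) = N (p \<bullet> q)"
  proof (cases "m = 0 \<and> x \<in> D")
    case True
    then show ?thesis
      using assms pq a_image_ideal(2)[of y x] by (cases n) (auto simp: prod_def bilinear_def)
  qed (use pq in \<open>auto simp: N_def\<close>)
  show "N (p \<bullet> N q) = N (p \<bullet> q)"
  proof (cases "n = 0 \<and> y \<in> D")
    case True
    then show ?thesis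
      using assms pq a_image_ideal(1)[of x y] by (cases m) (auto simp: prod_def bilinear_def)
  qed (use pq in \<open>auto simp: N_def\<close>)
qed

lemma prod_closed: "snd p \<in> X \<Longrightarrow> snd q \<in> X \<Longrightarrow> snd (p \<bullet> q) \<in> X"
  by (simp add: prod_def)

lemma prod_assoc: "snd p \<in> X \<Longrightarrow> snd q \<in> X \<Longrightarrow> snd r \<in> X \<Longrightarrow> p \<bullet> q \<bullet> r = p \<bullet> (q \<bullet> r)"
  by (simp add: prod_def f_assoc mult.assoc)

text \<open>Left multiplication by M is thus well defined on normal forms; for m = 0 this rests on a
  (a x) = a x.\<close>

lemma N_mult: "N (m * fst (N p), snd (N p)) = N (m * fst p, snd p)"
  by (cases "m = 0"; cases p) (auto simp: N_def)

lemma bit_mult_self: "(m::bit) * m = m"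
  by (cases m) auto

lemma N_prod_cong:
  assumes bilinear "snd p \<in> X" "snd q \<in> X" "snd p' \<in> X" "snd q' \<in> X" "N p = N p'" "N q = N q'"
  shows "N (p \<bullet> q) = N (p' \<bullet> q')"
  using assms N_prod N_X by metis

section \<open>Globalizations\<close>

lemma globalizable_imp_bilinear:
  assumes "globalizable \<alpha> X f"
  shows bilinear
proof -
  obtain \<beta> :: "bit \<Rightarrow> (bit \<times> 'a) list \<rightharpoonup> (bit \<times> 'a) list" and Y g \<iota>
    where glob: "globalization \<alpha> X f \<beta> Y g \<iota>"
    using assms by (auto simp: globalizable_def)
  define b where "b m y = the (\<beta> m y)" for m y
  have Y: "semigroup_on Y g" "semigroup_global_action \<beta> Y g"
    and mor: "action_morphism \<alpha> X f \<beta> Y g \<iota>"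
    and inj: "\<And>x y m. x \<in> X \<Longrightarrow> y \<in> X \<Longrightarrow> \<beta> m (\<iota> x) = Some (\<iota> y) \<Longrightarrow> \<alpha> m x = Some y"
    using glob by (auto simp: globalization_def)
  note b = global_actionD[OF Y(2,1), folded b_def]
  have \<iota>: "\<iota> x \<in> Y" "\<iota> (f x y) = g (\<iota> x) (\<iota> y)" if "x \<in> X" "y \<in> X" for x y
    using mor that by (auto simp: action_morphism_def semigroup_hom_on_def)
  have b0: "b 0 (\<iota> x) = \<iota> (a x)" if "x \<in> D" for x
    using mor that by (auto simp: action_morphism_def b_def a_def D_def)
  \<comment> \<open>The globalization property for m = 1 makes \<open>\<iota>\<close>
    injective.\<close>
  have inj1: "x = y" if "x \<in> X" "y \<in> X" "\<iota> x = \<iota> y" for x y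
    using inj[of x y 1] that b(1,3)[of "\<iota> x"] \<iota> \<alpha>_1 by auto
  show ?thesis unfolding bilinear_def
  proof (intro ballI conjI)
    fix x y assume xy: "x \<in> X" "y \<in> D"
    note D = D_subset[OF xy(2)] D_subset[OF a_D[OF xy(2)]]
    \<comment> \<open>\<open>b 0 (\<iota> x)\<close> need not lie in the image of
      \<open>\<iota>\<close>. The product on the right depends on \<open>y\<close> only through
      \<open>a y\<close>, so \<open>y\<close> may be replaced by \<open>a y\<close> in the next
      step.\<close>
    have "\<iota> (a (f x y)) = g (b 0 (\<iota> x)) (\<iota> (a y))"
      using b0[of "f x y"] b0[of y] b(5)[of "\<iota> x" "\<iota> y" 0] \<iota> xy D by simp
    also have "\<dots> = \<iota> (a (f x (a y)))"
      using b0[of "f x (a y)"] b0[of "a y"] b(5)[of "\<iota> x" "\<iota> (a y)" 0] \<iota> xy D by simp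
    finally show "a (f x y) = f x (a y)"
      using inj1 xy D a_image_ideal(1)[OF xy] by simp
    have "\<iota> (a (f y x)) = g (\<iota> (a y)) (b 0 (\<iota> x))"
      using b0[of "f y x"] b0[of y] b(5)[of "\<iota> y" "\<iota> x" 0] \<iota> xy D by simp
    also have "\<dots> = \<iota> (a (f (a y) x))"
      using b0[of "f (a y) x"] b0[of "a y"] b(5)[of "\<iota> (a y)" "\<iota> x" 0] \<iota> xy D by simp
    finally show "a (f y x) = f (a y) x"
      using inj1 xy D a_image_ideal(2)[OF xy] by simp
  qed
qed

lemma bilinear_imp_globalizable:
  assumes bil: bilinear
  shows "globalizable \<alpha> X f"
proof -
  \<comment> \<open>The normal forms over \<open>X\<close>, one for each class of
    \<open>XM \<alpha> X\<close>.\<close>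
  define Y where "Y = {p. snd p \<in> X \<and> N p = p}"
  define g where "g p q = N (p \<bullet> q)" for p q
  define b where "b m p = N (m * fst p, snd p)" for m :: bit and p
  have NN: "N (N p) = N p" for p
    by (cases p) (simp add: N_def)
  have N_Y: "N p \<in> Y" if "snd p \<in> X" for p
    using that N_X NN by (auto simp: Y_def)
  have Y: "snd p \<in> X" "N p = p" if "p \<in> Y" for p
    using that by (auto simp: Y_def)
  have sg: "semigroup_on Y g"
    unfolding semigroup_on_def g_def
    using Y N_Y by (simp add: prod_closed N_prod bil prod_assoc)
  define \<beta> where "\<beta> = (\<lambda>m p. if p \<in> Y then Some (b m p) else None)"
  have b_hom: "b m (g p q) = g (b m p) (b m q)" if pq: "p \<in> Y" "q \<in> Y" for m p q
  proof -
    have "b m (g p q) = N (m * fst (p \<bullet> q), snd (p \<bullet> q))"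
      by (simp only: b_def g_def N_mult)
    \<comment> \<open>Left multiplication by m respects products because m * m = m.\<close>
    also have "\<dots> = N ((m * fst p, snd p) \<bullet> (m * fst q, snd q))"
      using bit_mult_self[of m] by (simp add: prod_def ac_simps)
    also have "\<dots> = g (b m p) (b m q)"
      using pq Y by (simp add: b_def g_def N_prod bil N_X)
    finally show ?thesis .
  qed
  have "semigroup_global_action \<beta> Y g"
    unfolding \<beta>_def
  proof (rule global_actionI[OF _ _ _ b_hom sg])
    show "b n (b m y) = b (n * m) y" for m n y
      by (simp only: b_def N_mult mult.assoc fst_conv snd_conv)
  qed (use N_Y Y in \<open>auto simp: b_def\<close>)
  moreover have \<iota>: "(1, x) \<in> Y" if "x \<in> X" for x
    using that by (simp add: Y_def)
  have "action_morphism \<alpha> X f \<beta> Y g (Pair 1)"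
    unfolding action_morphism_def semigroup_hom_on_def
  proof (intro conjI allI ballI)
    fix m x assume "x \<in> dom (\<alpha> m)"
    then show "\<beta> m (1, x) = Some (1, the (\<alpha> m x))"
      using \<iota> D_subset[of x] \<alpha>_1[of x] \<alpha>_0[of x]
      by (cases m) (auto simp: \<beta>_def b_def D_def[symmetric] split: if_splits)
  qed (use \<iota> in \<open>auto simp: g_def prod_def\<close>)
  \<comment> \<open>For m = 0: \<open>N (0, x)\<close> has first component 1 only if x lies in
    \<open>D\<close>, and then its second component is \<open>a x\<close>.\<close>
  moreover have "\<alpha> m x = Some y" if "x \<in> X" "y \<in> X" "\<beta> m (1, x) = Some (1, y)" for m x y
    using that \<iota> \<alpha>_1[of x] \<alpha>_0[of x]
    by (cases m; cases "x \<in> D") (auto simp: \<beta>_def b_def split: if_splits)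
  ultimately have "globalization \<alpha> X f \<beta> Y g (Pair 1)"
    using sg by (auto simp: globalization_def)
  \<comment> \<open>The carrier built here consists of pairs; this transfers it to the type of words
    fixed in \<open>globalizable\<close>.\<close>
  then show ?thesis by (rule globalization_imp_globalizable[OF semigroup action])
qed

section \<open>Local confluence\<close>

lemma rewriteI:
  assumes "x \<in> X" "y \<in> X"
  shows "rewrite \<alpha> X f [XM_class \<alpha> m x, XM_class \<alpha> m y] [XM_class \<alpha> m (f x y)]"
  unfolding rewrite_def using assms by (intro bexI[of _ "[]"] exI[of _ m]) auto

lemma locally_confluent_imp_bilinear:
  assumes lc: "locally_confluent \<alpha> X f"
  shows bilinear
proof -
  \<comment> \<open>Other representatives at the same level m spell the same two-letter word. Both
    contractions are single letters, so joinability forces them to be equal.\<close>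
  have eq: "N (m, f x y) = N (m, f x' y')"
    if X: "x \<in> X" "y \<in> X" "x' \<in> X" "y' \<in> X" and e: "N (m, x) = N (m, x')" "N (m, y) = N (m, y')"
    for m x y x' y'
  proof -
    let ?w = "[XM_class \<alpha> m x, XM_class \<alpha> m y]"
    have "?w = [XM_class \<alpha> m x', XM_class \<alpha> m y']" using e by (simp add: XM_class_eq_iff)
    then have "rewrite \<alpha> X f ?w [XM_class \<alpha> m (f x y)]" "rewrite \<alpha> X f ?w [XM_class \<alpha> m (f x' y')]"
      using rewriteI[OF X(1,2), of m] rewriteI[OF X(3,4), of m] by argo+
    moreover have "?w \<in> XM_plus \<alpha> X" using X by (simp add: XM_plus_def XM_class_XM)
    ultimately obtain w where
      "(rewrite \<alpha> X f)\<^sup>*\<^sup>* [XM_class \<alpha> m (f x y)] w" "(rewrite \<alpha> X f)\<^sup>*\<^sup>* [XM_class \<alpha> m (f x' y')] w"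
      using lc unfolding locally_confluent_def locally_confluent_word_def by blast
    then have "[XM_class \<alpha> m (f x y)] = w" "[XM_class \<alpha> m (f x' y')] = w"
      by (auto elim: converse_rtranclpE simp: rewrite_singleton)
    then show ?thesis by (auto simp: XM_class_eq_iff)
  qed
  show ?thesis unfolding bilinear_def
  proof (intro ballI conjI)
    fix x y assume xy: "x \<in> X" "y \<in> D"
    \<comment> \<open>At level 0, \<open>y\<close> and \<open>a y\<close> represent the same letter:
      both normalize to (1, a y).\<close>
    then show "a (f x y) = f x (a y)"
      using eq[of x y x "a y" 0] D_subset a_image_ideal(1) by auto
    show "a (f y x) = f (a y) x"
      using xy eq[of y x "a y" x 0] D_subset a_image_ideal(2) by auto
  qed
qed

text \<open>A class with representatives at both levels lies in the ideal \<open>ran (\<alpha> 0)\<close>, so multiplying it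
  does not destroy either representative.\<close>

lemma level_change:
  assumes "x \<in> X" "y \<in> X" "y' \<in> X" "N (m, y) = N (n, y')"
  shows "\<exists>w\<in>X. N (m, f x y) = N (n, w)" "\<exists>w\<in>X. N (m, f y x) = N (n, w)"
proof -
  have "(\<exists>w\<in>X. N (m, f x y) = N (n, w)) \<and> (\<exists>w\<in>X. N (m, f y x) = N (n, w))"
  proof (cases "m = n")
    case True
    then show ?thesis using assms by auto
  next
    case False
    then consider "m = 0" "n = 1" | "m = 1" "n = 0" by (cases m; cases n) auto
    then show ?thesis
    proof cases
      case 1
      then have "y \<in> D" using assms by (cases "y \<in> D") auto
      then have "N (m, f x y) = N (n, a (f x y))" "N (m, f y x) = N (n, a (f y x))"
        using 1 assms by auto
      then show ?thesis using assms \<open>y \<in> D\<close> by (metis D_ideal a_X)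
    next
      case 2
      then have y': "y' \<in> D" "y = a y'" using assms by (cases "y' \<in> D"; auto)+
      then have "N (m, f x y) = N (n, f x y)" "N (m, f y x) = N (n, f y x)"
        using 2 assms a_image_ideal[of x y'] by auto
      then show ?thesis using assms by (meson f_closed)
    qed
  qed
  then show "\<exists>w\<in>X. N (m, f x y) = N (n, w)" "\<exists>w\<in>X. N (m, f y x) = N (n, w)" by auto
qed

lemma bilinear_imp_locally_confluent:
  assumes bil: bilinear
  shows "locally_confluent \<alpha> X f"
proof -
  \<comment> \<open>The partial product of classes: it is defined when both have representatives at
    a common level.\<close>
  define P where "P A B C \<longleftrightarrow> (\<exists>m. \<exists>x\<in>X. \<exists>y\<in>X.
    A = XM_class \<alpha> m x \<and> B = XM_class \<alpha> m y \<and> C = XM_class \<alpha> m (f x y))" for A B C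
  have N_diag: "N (m, f x y) = N ((m, x) \<bullet> (m, y))" for m x y
    using bit_mult_self[of m] by (simp add: prod_def)
  have "locally_confluent_word (rewrite \<alpha> X f) w" for w
  proof (rule locally_confluent_partial_product[where C = "XM \<alpha> X" and P = P])
    show "rewrite \<alpha> X f w w' \<longleftrightarrow> (\<exists>u\<in>lists (XM \<alpha> X). \<exists>v\<in>lists (XM \<alpha> X). \<exists>p q r.
        P p q r \<and> w = u @ [p, q] @ v \<and> w' = u @ [r] @ v)" for w w'
      unfolding rewrite_def P_def by blast
    show "A \<in> XM \<alpha> X \<and> B \<in> XM \<alpha> X \<and> C \<in> XM \<alpha> X" if "P A B C" for A B C
      using that by (auto simp: P_def XM_class_XM)
    show "C = C'" if PP: "P A B C" "P A B C'" for A B C C'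
    proof -
      obtain m x y n x' y' where X: "x \<in> X" "y \<in> X" "x' \<in> X" "y' \<in> X"
        and "A = XM_class \<alpha> m x" "B = XM_class \<alpha> m y" "A = XM_class \<alpha> n x'" "B = XM_class \<alpha> n y'"
        and C: "C = XM_class \<alpha> m (f x y)" "C' = XM_class \<alpha> n (f x' y')"
        using PP unfolding P_def by blast
      then have "N (m, x) = N (n, x')" "N (m, y) = N (n, y')"
        using XM_class_eq_iff by auto
      then show ?thesis
        using C X bil by (auto simp: XM_class_eq_iff N_diag intro!: N_prod_cong)
    qed
    show "\<exists>F. P S C F \<and> P A T F" if PP: "P A B S" "P B C T" for A B C S T
    proof -
      obtain m x y n y' z where X: "x \<in> X" "y \<in> X" "y' \<in> X" "z \<in> X"
        and cl: "A = XM_class \<alpha> m x" "B = XM_class \<alpha> m y" "B = XM_class \<alpha> n y'" "C = XM_class \<alpha> n z"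
        and ST: "S = XM_class \<alpha> m (f x y)" "T = XM_class \<alpha> n (f y' z)"
        using PP unfolding P_def by blast
      have y: "N (m, y) = N (n, y')" using cl by (metis XM_class_eq_iff)
      \<comment> \<open>The middle letter \<open>B\<close> is read at level m in \<open>A B\<close>
        and at level n in \<open>B C\<close>. Moving \<open>S\<close> to level n and
        \<open>T\<close> to level m makes the products \<open>S C\<close> and \<open>A T\<close>
        available.\<close>
      obtain s where s: "s \<in> X" "N (m, f x y) = N (n, s)"
        using level_change(1)[OF X(1-3) y] by blast
      obtain t where t: "t \<in> X" "N (n, f y' z) = N (m, t)"
        using level_change(2)[OF X(4,3,2) y[symmetric]] by blast
      \<comment> \<open>The chain is associativity of \<open>\<bullet>\<close> modulo
        \<open>N\<close>, with the middle letter exchanged from (m, y) to (n, y').\<close>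
      have "N (n, f s z) = N ((m, f x y) \<bullet> (n, z))"
        unfolding N_diag[of n] using s X bil by (intro N_prod_cong) auto
      also have "\<dots> = N ((m, x) \<bullet> (m, y) \<bullet> (n, z))"
        using X bil N_diag[of m x y] by (intro N_prod_cong) (auto simp: prod_closed)
      also have "\<dots> = N ((m, x) \<bullet> ((m, y) \<bullet> (n, z)))"
        using X by (simp add: prod_assoc)
      also have "\<dots> = N ((m, x) \<bullet> (n, f y' z))"
        using X bil y N_prod_cong[of "(m, y)" "(n, z)" "(n, y')" "(n, z)"] N_diag[of n y' z]
        by (intro N_prod_cong) (auto simp: prod_closed)
      also have "\<dots> = N (m, f x t)"
        unfolding N_diag[of m] using t X bil by (intro N_prod_cong) auto
      finally have e: "XM_class \<alpha> n (f s z) = XM_class \<alpha> m (f x t)" by (simp add: XM_class_eq_iff)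
      have "S = XM_class \<alpha> n s" "T = XM_class \<alpha> m t"
        using ST s t by (simp_all add: XM_class_eq_iff)
      then have "P S C (XM_class \<alpha> n (f s z))" "P A T (XM_class \<alpha> m (f x t))"
        using cl s t X unfolding P_def by blast+
      then show ?thesis using e by auto
    qed
  qed
  then show ?thesis by (simp add: locally_confluent_def)
qed

end

theorem corollary4p1:
  fixes \<alpha> :: "bit \<Rightarrow> 'a \<rightharpoonup> 'a" and X :: "'a set" and f :: "'a \<Rightarrow> 'a \<Rightarrow> 'a"
  assumes "semigroup_on X f"
    and "semigroup_partial_action \<alpha> X f"
    and "ideal_on (dom (\<alpha> 0)) X f"
    and "ideal_on (ran (\<alpha> 0)) X f"
  shows "(globalizable \<alpha> X f \<longleftrightarrow> locally_confluent \<alpha> X f) \<and>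
         (locally_confluent \<alpha> X f \<longleftrightarrow>
           (\<forall>y \<in> dom (\<alpha> 0). \<forall>x \<in> adj_carrier X. \<forall>z \<in> adj_carrier X.
              \<exists>w w'. Elt w = adj_mult f (adj_mult f x (Elt y)) z \<and>
                     \<alpha> 0 w = Some w' \<and>
                     Elt w' = adj_mult f (adj_mult f x (Elt (the (\<alpha> 0 y)))) z))"
proof -
  interpret bit_partial_action \<alpha> X f by unfold_locales (fact assms)+
  show ?thesis
    unfolding bilinear_iff[symmetric]
    using globalizable_imp_bilinear bilinear_imp_globalizable
      locally_confluent_imp_bilinear bilinear_imp_locally_confluent by blast
qed

end
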